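(* Let $(A_n)_{n=1}^\infty$ be a homogeneous admissible set system in $[0,1]^k$ with parameter $\tau$ (see context). Then, for all $n,n'\in\mathbb{N}$, \[ \lambda(A_n\cap(A_{n'}+\boldsymbol\gamma))\le\lambda(A_n)\lambda(A_{n'})+O\!\left(\min\Bigl\{\frac{\lambda(A_n)}{n^k},\frac{\lambda(A_{n'})}{(n')^k}\Bigr\}\gcd(n,n')^k\left(1+\frac{n^{\tau-1-1/k}+(n')^{\tau-1-1/k}}{\gcd(n,n')/(nn')}\right)^{k-1}\right), \] uniformly for all $\boldsymbol\gamma\in\mathbb{R}^k$.
   Context: $\lambda$ is Lebesgue measure, with sets regarded modulo $\mathbb{Z}^k$ (i.e. on the torus $[0,1)^k$); $\|\cdot\|$ is the distance to the nearest integer. Admissible set system: fix $\tau\in(0,1/k)$ and $\mathbf{y}\in\mathbb{R}^k$ ($\mathbf{y}=\mathbf{0}$ for a homogeneous system). For $m\in\mathbb{N}$ let $D_m=[2^{m-1},2^m)$. For each $m$ choose a finite index set $I_m$ and, for $i\in I_m$, $1\le j\le k$, numbers $d_{i,j}=d_{i,j,m}>0$ with $d_{i,j}\le1/(2n)$ and $n^{-(1+1/k+\tau)}\ll d_{i,j}\ll n^{-(1+1/k-\tau)}$ for all $n\in D_m$, such that $\prod_jd_{i,j}$ does not depend on $i$. To each $(i,j)$ associate $\mathcal{U}_{i,j}$ equal to $[0,nd_{i,j})$ or $[nd_{i,j}/2,nd_{i,j})$. For $n\in D_m$ let $A_n=\bigcup_{i\in I_m}\{\mathbf{x}\in[0,1]^k:\|nx_j-y_j\|\in\mathcal{U}_{i,j}\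 \forall j\}$, required to be a disjoint union and to satisfy Property $\mathcal{P}_n(\mathbf{y})$: modulo $\mathbb{Z}^k$, $A_n=\mathcal{Z}+n^{-1}(\mathbf{y}+\mathbb{Z}^k)$ for some strongly star-shaped $\mathcal{Z}\subseteq[-1/2,1/2]^k$ (meaning $\mathbf{x}\in\mathcal{Z}$ and $|z_j|\le|x_j|$ for all $j$ imply $\mathbf{z}\in\mathcal{Z}$). Implied constants may depend on $k$ and on the implied constants in the bounds for $d_{i,j}$. *)

theory Defs
  imports "HOL-Analysis.Analysis"
begin

definition int_dist :: "real \<Rightarrow> real" where
  "int_dist t = \<bar>t - of_int (round t)\<bar>"

definition int_lattice :: "(real ^ 'k) set" where
  "int_lattice = {q. \<forall>j. q $ j \<in> \<int>}"

text \<open>A subset of the torus is represented by its full preimage in the covering space, so two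
  sets agree modulo the integer lattice iff their periodizations are equal, and the intersection of
  two sets taken modulo the lattice is the intersection of their periodizations.\<close>

definition periodize :: "(real ^ 'k) set \<Rightarrow> (real ^ 'k) set" where
  "periodize S = {x + q | x q. x \<in> S \<and> q \<in> int_lattice}"

definition torus_measure :: "(real ^ 'k) set \<Rightarrow> real" where
  "torus_measure S = measure lebesgue (periodize S \<inter> {x. \<forall>j. 0 \<le> x $ j \<and> x $ j < 1})"

definition strongly_star_shaped :: "(real ^ 'k) set \<Rightarrow> bool" where
  "strongly_star_shaped Z \<longleftrightarrow> (\<forall>x\<in>Z. \<forall>z. (\<forall>j. \<bar>z $ j\<bar> \<le> \<bar>x $ j\<bar>) \<longrightarrow> z \<in> Z)"

definition property_P :: "nat \<Rightarrow> real ^ 'k \<Rightarrow> (real ^ 'k) set \<Rightarrow> bool" where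
  "property_P n y S \<longleftrightarrow>
     (\<exists>Z. Z \<subseteq> {x. \<forall>j. \<bar>x $ j\<bar> \<le> 1 / 2} \<and> strongly_star_shaped Z \<and>
          periodize S =
            periodize {z + (1 / real n) *\<^sub>R (y + q) | z q. z \<in> Z \<and> q \<in> int_lattice})"

definition dyadic_block :: "nat \<Rightarrow> nat set" where
  "dyadic_block m = {2 ^ (m - 1) ..< 2 ^ m}"

definition approx_set :: "nat \<Rightarrow> real ^ 'k \<Rightarrow> ('k \<Rightarrow> real set) \<Rightarrow> (real ^ 'k) set" where
  "approx_set n y V =
     {x. (\<forall>j. 0 \<le> x $ j \<and> x $ j \<le> 1) \<and> (\<forall>j. int_dist (real n * x $ j - y $ j) \<in> V j)}"

text \<open>The parameters \<open>c\<close> and \<open>C\<close> are the implied constants in the lower and upper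
  bounds for the numbers \<open>d m i j\<close>. Finite index sets are taken to be sets of natural numbers
  without loss of generality. The interval \<open>U n i j\<close> depends on \<open>n\<close>, and either of its two
  permitted forms may be taken for each \<open>n\<close> of the block.\<close>

definition admissible_system ::
  "real \<Rightarrow> real ^ 'k \<Rightarrow> real \<Rightarrow> real \<Rightarrow> (nat \<Rightarrow> (real ^ 'k) set) \<Rightarrow> bool" where
  "admissible_system \<tau> y c C A \<longleftrightarrow>
     0 < \<tau> \<and> \<tau> < 1 / real CARD('k) \<and>
     (\<exists>(I :: nat \<Rightarrow> nat set) (d :: nat \<Rightarrow> nat \<Rightarrow> 'k \<Rightarrow> real) (U :: nat \<Rightarrow> nat \<Rightarrow> 'k \<Rightarrow> real set).
        \<forall>m\<ge>1.
          finite (I m) \<and>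
          (\<forall>i\<in>I m. \<forall>j. 0 < d m i j) \<and>
          (\<forall>i\<in>I m. \<forall>j. \<forall>n\<in>dyadic_block m.
             d m i j \<le> 1 / (2 * real n) \<and>
             c * real n powr (- (1 + 1 / real CARD('k) + \<tau>)) \<le> d m i j \<and>
             d m i j \<le> C * real n powr (- (1 + 1 / real CARD('k) - \<tau>))) \<and>
          (\<forall>i\<in>I m. \<forall>i'\<in>I m. (\<Prod>j\<in>UNIV. d m i j) = (\<Prod>j\<in>UNIV. d m i' j)) \<and>
          (\<forall>n\<in>dyadic_block m.
             (\<forall>i\<in>I m. \<forall>j. U n i j = {0 ..< real n * d m i j} \<or>
                            U n i j = {real n * d m i j / 2 ..< real n * d m i j}) \<and>
             A n = (\<Union>i\<in>I m. approx_set n y (U n i)) \<and>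
             disjoint_family_on (\<lambda>i. approx_set n y (U n i)) (I m) \<and>
             property_P n y (A n)))"

end

(* Each A n is, modulo the lattice, the preimage under multiplication by n of a symmetric,
   coordinatewise downward closed set S of half-width at most C n powr (tau - 1/k), and its torus
   measure is vol S. Since A n is invariant under translation by a/n for integer vectors a,
   averaging over these translations turns the measure of the overlap of A n with a translate of
   A n' into an integral over A n of the number of a modulo n with x + a/n in that translate.
   That number is gcd(n, n')^k times a count of points of a shifted lattice (1/N) Z^k,
   N = n / gcd(n, n'), in the set S' belonging to n', which exceeds N^k vol S' at most by the
   number of lattice points of S' close to a coordinate hyperplane. Exchanging n and n' gives the
   minimum. *)
theory Submission imports Defs begin

section \<open>Periodic sets and fundamental domains of the integer lattice\<close>

definition periodic :: "(real ^ 'k) set \<Rightarrow> bool" where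
  "periodic F \<longleftrightarrow> (\<forall>x. \<forall>q\<in>int_lattice. x + q \<in> F \<longleftrightarrow> x \<in> F)"

text \<open>Each lattice coset is met exactly once, with no exceptional null set, so the lattice
  translates of \<open>D\<close> form a countable Borel partition of the whole space.\<close>

definition fundamental_domain :: "(real ^ 'k) set \<Rightarrow> bool" where
  "fundamental_domain D \<longleftrightarrow> D \<in> sets borel \<and> (\<forall>x. \<exists>!q. q \<in> int_lattice \<and> x - q \<in> D)"

definition unit_cube :: "(real ^ 'k) set" where
  "unit_cube = {x. \<forall>j. 0 \<le> x $ j \<and> x $ j < 1}"

lemma int_lattice_0 [simp]: "0 \<in> int_lattice"
  by (simp add: int_lattice_def)

lemma int_lattice_add: "p \<in> int_lattice \<Longrightarrow> q \<in> int_lattice \<Longrightarrow> p + q \<in> int_lattice"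
  by (simp add: int_lattice_def)

lemma int_lattice_minus [simp]: "- q \<in> int_lattice \<longleftrightarrow> q \<in> int_lattice"
  using minus_in_Ints_iff by (auto simp: int_lattice_def)

lemma int_lattice_of_int [simp]: "(\<chi> j. of_int (f j)) \<in> int_lattice"
  by (simp add: int_lattice_def)

lemma int_lattice_eq_range: "int_lattice = range (\<lambda>f. \<chi> j. of_int (f j))"
proof -
  have "q \<in> range (\<lambda>f. \<chi> j. of_int (f j))" if "q \<in> int_lattice" for q :: "real ^ 'k"
  proof -
    from that have "\<forall>j. \<exists>a::int. q $ j = of_int a"
      by (auto simp: int_lattice_def elim!: Ints_cases)
    then obtain f :: "'k \<Rightarrow> int" where "\<forall>j. q $ j = of_int (f j)" by metis
    then have "q = (\<chi> j. of_int (f j))" by (simp add: vec_eq_iff)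
    then show ?thesis by blast
  qed
  then show ?thesis by (auto simp: int_lattice_def)
qed

lemma countable_int_lattice: "countable (int_lattice :: (real ^ 'k) set)"
  unfolding int_lattice_eq_range by (rule countable_image) simp

lemma periodize_iff: "x \<in> periodize S \<longleftrightarrow> (\<exists>q\<in>int_lattice. x - q \<in> S)"
proof
  assume "x \<in> periodize S"
  then obtain y q where "x = y + q" "y \<in> S" "q \<in> int_lattice" by (auto simp: periodize_def)
  then show "\<exists>q\<in>int_lattice. x - q \<in> S" by (intro bexI[of _ q]) auto
next
  assume "\<exists>q\<in>int_lattice. x - q \<in> S"
  then obtain q where "q \<in> int_lattice" "x - q \<in> S" by blast
  then show "x \<in> periodize S"
    unfolding periodize_def using diff_add_cancel[of x q] by force
qed

lemma periodicI: "(\<And>x q. q \<in> int_lattice \<Longrightarrow> x \<in> F \<Longrightarrow> x + q \<in> F) \<Longrightarrow> periodic F"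
  unfolding periodic_def by (metis add_diff_cancel diff_conv_add_uminus int_lattice_minus)

lemma periodic_periodize: "periodic (periodize S)"
proof (rule periodicI)
  fix x q :: "real ^ 'a" assume q: "q \<in> int_lattice" and "x \<in> periodize S"
  then obtain p where "p \<in> int_lattice" "x - p \<in> S" by (auto simp: periodize_iff)
  with q have "p + q \<in> int_lattice" "x + q - (p + q) \<in> S" by (auto intro: int_lattice_add)
  then show "x + q \<in> periodize S" unfolding periodize_iff by blast
qed

lemma periodize_periodic: "periodic F \<Longrightarrow> periodize F = F"
  unfolding periodic_def set_eq_iff periodize_iff
  by (metis diff_add_cancel diff_zero int_lattice_0)

lemma periodize_translate: "periodize ((\<lambda>x. x + v) ` S) = {x. x - v \<in> periodize S}"
proof -
  have "x - q \<in> (\<lambda>x. x + v) ` S \<longleftrightarrow> x - v - q \<in> S" for x q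
    by (auto simp: image_iff algebra_simps intro!: bexI[of _ "x - v - q"])
  then show ?thesis by (simp add: periodize_iff set_eq_iff)
qed

lemma periodic_translate:
  assumes "periodic F" shows "periodic {x. x + v \<in> F}"
proof (rule periodicI)
  fix x q :: "real ^ 'a" assume "q \<in> int_lattice" "x \<in> {x. x + v \<in> F}"
  then have "x + v + q \<in> F" using assms by (auto simp: periodic_def)
  then show "x + q \<in> {x. x + v \<in> F}" by (simp add: add_ac)
qed

lemma periodic_Int: "periodic F \<Longrightarrow> periodic G \<Longrightarrow> periodic (F \<inter> G)"
  by (auto simp: periodic_def)

lemma periodic_scale:
  assumes "periodic F" shows "periodic {x. real n *\<^sub>R x \<in> F}"
proof (rule periodicI)
  fix x q :: "real ^ 'a" assume "q \<in> int_lattice" and x: "x \<in> {x. real n *\<^sub>R x \<in> F}"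
  then have "real n *\<^sub>R q \<in> int_lattice" by (simp add: int_lattice_def)
  with x show "x + q \<in> {x. real n *\<^sub>R x \<in> F}"
    using assms by (auto simp: scaleR_add_right periodic_def)
qed

section \<open>Borel sets and Lebesgue measure under translation and dilation\<close>

lemma borel_vimage: "f \<in> borel_measurable borel \<Longrightarrow> F \<in> sets borel \<Longrightarrow> {x. f x \<in> F} \<in> sets borel"
  using measurable_sets[of f borel borel F] by (simp add: vimage_def)

lemma borel_translate: "F \<in> sets borel \<Longrightarrow> {x. x + (v :: real ^ 'k) \<in> F} \<in> sets borel"
  by (intro borel_vimage[of "\<lambda>x. x + v"]) (simp_all add: borel_measurable_continuous_onI continuous_intros)

lemma borel_scale: "F \<in> sets borel \<Longrightarrow> {x. c *\<^sub>R (x :: real ^ 'k) \<in> F} \<in> sets borel"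
  by (intro borel_vimage[of "\<lambda>x. c *\<^sub>R x"]) (simp_all add: borel_measurable_continuous_onI continuous_intros)

lemma borel_periodize:
  assumes "S \<in> sets borel" shows "periodize S \<in> sets borel"
proof -
  have "periodize S = (\<Union>q\<in>int_lattice. {x. x + (- q) \<in> S})" by (auto simp: periodize_iff)
  then show ?thesis using assms countable_int_lattice by (auto intro!: sets.countable_UN' borel_translate)
qed

lemma emeasure_lborel_translate:
  fixes v :: "real ^ 'k"
  assumes "B \<in> sets borel" shows "emeasure lborel {x. x + v \<in> B} = emeasure lborel B"
proof -
  have "emeasure lborel B = emeasure (distr lborel borel ((+) v)) B" by (simp add: lborel_distr_plus)
  also have "\<dots> = emeasure lborel ((+) v -` B)"
    using assms by (subst emeasure_distr) auto
  finally show ?thesis by (simp add: vimage_def add.commute)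
qed

lemma emeasure_lborel_scale:
  fixes B :: "(real ^ 'k) set"
  assumes "B \<in> sets borel" "0 < c"
  shows "emeasure lborel B = ennreal (c ^ CARD('k)) * emeasure lborel {x. c *\<^sub>R x \<in> B}"
proof -
  have "emeasure lborel B = emeasure (density (distr lborel borel (\<lambda>x. 0 + c *\<^sub>R x)) (\<lambda>_. ennreal (\<bar>c\<bar> ^ DIM(real ^ 'k)))) B"
    using assms lborel_affine[of c "0 :: real ^ 'k"] by simp
  also have "\<dots> = ennreal (c ^ CARD('k)) * emeasure lborel ((*\<^sub>R) c -` B)"
    using assms by (subst emeasure_density_const) (auto simp: emeasure_distr)
  finally show ?thesis by (simp add: vimage_def)
qed

section \<open>Measure of periodic sets on the torus\<close>

text \<open>Cut \<open>F \<inter> D\<close> along the lattice translates of \<open>E\<close> and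
  move each piece back by its lattice vector. Since \<open>F\<close> is periodic, the moved pieces
  are those of \<open>F \<inter> E\<close> cut along the translates of \<open>D\<close>.\<close>

lemma emeasure_fundamental_domain:
  assumes F: "periodic F" "F \<in> sets borel"
    and D: "fundamental_domain D" "fundamental_domain E"
  shows "emeasure lborel (F \<inter> D) = emeasure lborel (F \<inter> E)"
proof -
  have b: "D \<in> sets borel" "E \<in> sets borel" using D by (auto simp: fundamental_domain_def)
  have split: "emeasure lborel (F \<inter> G) = (\<integral>\<^sup>+q. emeasure lborel (F \<inter> G \<inter> {x. x + (- q) \<in> H}) \<partial>count_space int_lattice)"
    if G: "G \<in> sets borel" and H: "fundamental_domain H" for G H :: "(real ^ 'a) set"
  proof -
    have *: "F \<inter> G = (\<Union>q\<in>int_lattice. F \<inter> G \<inter> {x. x + (- q) \<in> H})"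
      using H unfolding fundamental_domain_def by auto
    have "disjoint_family_on (\<lambda>q. F \<inter> G \<inter> {x. x + (- q) \<in> H}) int_lattice"
      using H unfolding fundamental_domain_def disjoint_family_on_def by auto
    moreover have "F \<inter> G \<inter> {x. x + (- q) \<in> H} \<in> sets lborel" for q
      using borel_translate[of H "- q"] F G H by (auto simp: fundamental_domain_def)
    ultimately show ?thesis
      by (subst *, subst emeasure_UN_countable) (auto simp: countable_int_lattice)
  qed
  have "emeasure lborel (F \<inter> D) = (\<integral>\<^sup>+q. emeasure lborel (F \<inter> D \<inter> {x. x + (- q) \<in> E}) \<partial>count_space int_lattice)"
    using split[OF b(1) D(2)] .
  also have "\<dots> = (\<integral>\<^sup>+q. emeasure lborel (F \<inter> E \<inter> {x. x + q \<in> D}) \<partial>count_space int_lattice)"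
  proof (rule nn_integral_cong)
    fix q :: "real ^ 'a" assume "q \<in> space (count_space int_lattice)"
    then have "F \<inter> E \<inter> {x. x + q \<in> D} = {x. x + q \<in> F \<inter> D \<inter> {x. x + (- q) \<in> E}}"
      using F by (auto simp: periodic_def)
    moreover have "F \<inter> D \<inter> {x. x + (- q) \<in> E} \<in> sets borel"
      using b F borel_translate[of E "- q"] by auto
    ultimately show "emeasure lborel (F \<inter> D \<inter> {x. x + (- q) \<in> E}) = emeasure lborel (F \<inter> E \<inter> {x. x + q \<in> D})"
      using emeasure_lborel_translate by metis
  qed
  \<comment> \<open>\<open>split\<close> describes the translates of \<open>D\<close> through
    \<open>x - q\<close>, so the sum is reindexed by \<open>q \<mapsto> - q\<close>.\<close>
  also have "\<dots> = (\<integral>\<^sup>+q. emeasure lborel (F \<inter> E \<inter> {x. x + (- q) \<in> D}) \<partial>count_space int_lattice)"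
  proof -
    have "bij_betw uminus (int_lattice :: (real ^ 'a) set) int_lattice"
      by (rule bij_betw_byWitness[where f' = uminus]) auto
    from nn_integral_bij_count_space[OF this, of "\<lambda>q. emeasure lborel (F \<inter> E \<inter> {x. x + q \<in> D})"]
    show ?thesis by simp
  qed
  also have "\<dots> = emeasure lborel (F \<inter> E)"
    using split[OF b(2) D(1)] by simp
  finally show ?thesis .
qed

lemma fundamental_domain_half_open:
  "fundamental_domain {x :: real ^ 'k. \<forall>j. a \<le> x $ j \<and> x $ j < a + 1}" (is "fundamental_domain ?D")
  unfolding fundamental_domain_def
proof (intro conjI allI)
  have "?D = (\<Inter>j. {x. a \<le> x $ j} \<inter> {x. x $ j < a + 1})" by auto
  also have "\<dots> \<in> sets borel" by (intro sets.countable_INT') (auto intro!: borel_measurable_le borel_measurable_less)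
  finally show "?D \<in> sets borel" .
  fix x :: "real ^ 'k"
  show "\<exists>!q. q \<in> int_lattice \<and> x - q \<in> ?D"
  proof (rule ex1I[of _ "\<chi> j. of_int \<lfloor>x $ j - a\<rfloor>"])
    show "(\<chi> j. of_int \<lfloor>x $ j - a\<rfloor>) \<in> int_lattice \<and> x - (\<chi> j. of_int \<lfloor>x $ j - a\<rfloor>) \<in> ?D"
      by simp linarith
    fix q assume q: "q \<in> int_lattice \<and> x - q \<in> ?D"
    then obtain f :: "'k \<Rightarrow> int" where f: "q = (\<chi> j. of_int (f j))" by (auto simp: int_lattice_eq_range)
    have "\<lfloor>x $ j - a\<rfloor> = f j" for j
    proof -
      from q have "a \<le> x $ j - f j" "x $ j - f j < a + 1" unfolding f by auto
      then show ?thesis by (simp add: floor_eq_iff)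
    qed
    then show "q = (\<chi> j. of_int \<lfloor>x $ j - a\<rfloor>)" unfolding f by simp
  qed
qed

lemma fundamental_domain_unit_cube: "fundamental_domain unit_cube"
  using fundamental_domain_half_open[of 0] by (simp add: unit_cube_def)

lemma fundamental_domain_translate:
  fixes v :: "real ^ 'k"
  assumes "fundamental_domain D" shows "fundamental_domain {x. x + v \<in> D}"
  unfolding fundamental_domain_def
proof (intro conjI allI)
  show "{x. x + v \<in> D} \<in> sets borel" using assms by (auto simp: fundamental_domain_def intro: borel_translate)
  fix x
  have "\<exists>!q. q \<in> int_lattice \<and> (x + v) - q \<in> D" using assms by (auto simp: fundamental_domain_def)
  then show "\<exists>!q. q \<in> int_lattice \<and> x - q \<in> {x. x + v \<in> D}" by (simp add: algebra_simps)
qed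

lemma borel_unit_cube [simp]: "unit_cube \<in> sets borel"
  using fundamental_domain_unit_cube by (auto simp: fundamental_domain_def)

text \<open>A translate of the unit cube is again a fundamental domain, and translating
  \<open>F\<close> amounts to measuring it over that domain instead.\<close>

lemma emeasure_torus_translate:
  assumes "periodic F" "F \<in> sets borel"
  shows "emeasure lborel ({x. x + v \<in> F} \<inter> unit_cube) = emeasure lborel (F \<inter> unit_cube)"
proof -
  let ?D = "{x. x + (- v) \<in> unit_cube}"
  have D: "fundamental_domain ?D"
    by (intro fundamental_domain_translate fundamental_domain_unit_cube)
  then have "?D \<in> sets borel" by (simp add: fundamental_domain_def)
  then have "emeasure lborel (F \<inter> ?D) = emeasure lborel {x. x + v \<in> F \<inter> ?D}"
    using assms by (subst emeasure_lborel_translate) auto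
  also have "{x. x + v \<in> F \<inter> ?D} = {x. x + v \<in> F} \<inter> unit_cube" by auto
  finally show ?thesis
    using emeasure_fundamental_domain[OF assms D fundamental_domain_unit_cube] by simp
qed

lemma finite_grid: "finite {a :: 'k::finite \<Rightarrow> int. \<forall>j. 0 \<le> a j \<and> a j < int n}"
  and card_grid: "card {a :: 'k::finite \<Rightarrow> int. \<forall>j. 0 \<le> a j \<and> a j < int n} = n ^ CARD('k)"
proof -
  have *: "{a :: 'k \<Rightarrow> int. \<forall>j. 0 \<le> a j \<and> a j < int n} = (\<Pi>\<^sub>E j\<in>UNIV. {0..<int n})"
    by (auto simp: PiE_def)
  show "finite {a :: 'k::finite \<Rightarrow> int. \<forall>j. 0 \<le> a j \<and> a j < int n}"
    unfolding * by (intro finite_PiE) auto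
  show "card {a :: 'k::finite \<Rightarrow> int. \<forall>j. 0 \<le> a j \<and> a j < int n} = n ^ CARD('k)"
    unfolding * by (subst card_PiE) auto
qed

text \<open>Dilation by \<open>n\<close> carries the unit cube onto a cube of side \<open>n\<close>,
  which consists of \<open>n ^ CARD('k)\<close> lattice translates of the unit cube, each meeting
  \<open>F\<close> in the same measure. This number cancels the Jacobian of the dilation.\<close>

lemma emeasure_torus_scale:
  fixes F :: "(real ^ 'k) set"
  assumes F: "periodic F" "F \<in> sets borel" and n: "0 < n"
  shows "emeasure lborel ({x. real n *\<^sub>R x \<in> F} \<inter> unit_cube) = emeasure lborel (F \<inter> unit_cube)"
proof -
  let ?A = "{a :: 'k \<Rightarrow> int. \<forall>j. 0 \<le> a j \<and> a j < int n}"
  define v where "v a = (\<chi> j. - real_of_int (a j))" for a :: "'k \<Rightarrow> int"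
  \<comment> \<open>\<open>B\<close> is the part of \<open>F\<close> in the half-open cube of side
    \<open>n\<close>, listed by unit cells; \<open>a\<close> is the lower corner of a cell.\<close>
  define B where "B = (\<Union>a\<in>?A. F \<inter> {x. x + v a \<in> unit_cube})"
  have meas: "F \<inter> {x. x + v a \<in> unit_cube} \<in> sets borel" for a
    by (intro sets.Int borel_translate F borel_unit_cube)
  have B: "B \<in> sets borel" unfolding B_def using meas finite_grid by (intro sets.finite_UN) auto
  have B_iff: "real n *\<^sub>R x \<in> B \<longleftrightarrow> real n *\<^sub>R x \<in> F \<and> x \<in> unit_cube" for x
  proof
    assume "real n *\<^sub>R x \<in> B"
    then obtain a where a: "a \<in> ?A" "real n *\<^sub>R x \<in> F" "real n *\<^sub>R x + v a \<in> unit_cube"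
      by (auto simp: B_def)
    have "0 \<le> x $ j \<and> x $ j < 1" for j
    proof -
      from a have "0 \<le> real n * x $ j - a j" "real n * x $ j - a j < 1" "0 \<le> a j" "a j \<le> int n - 1"
        by (auto simp: unit_cube_def v_def)
      moreover then have "real_of_int (a j) \<le> real n - 1"
        by linarith
      ultimately have "0 \<le> real n * x $ j" "real n * x $ j < real n * 1" by linarith+
      then show ?thesis using n by (auto simp: zero_le_mult_iff)
    qed
    with a show "real n *\<^sub>R x \<in> F \<and> x \<in> unit_cube" by (simp add: unit_cube_def)
  next
    assume x: "real n *\<^sub>R x \<in> F \<and> x \<in> unit_cube"
    define a where "a = (\<lambda>j. \<lfloor>real n * x $ j\<rfloor>)"
    have "a \<in> ?A" using x n by (auto simp: a_def unit_cube_def floor_less_iff)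
    moreover have "real n *\<^sub>R x + v a \<in> unit_cube"
      by (simp add: unit_cube_def v_def a_def) linarith
    ultimately show "real n *\<^sub>R x \<in> B" using x by (auto simp: B_def)
  qed
  have disj: "disjoint_family_on (\<lambda>a. F \<inter> {x. x + v a \<in> unit_cube}) ?A"
  proof -
    have "a = b" if "x + v a \<in> unit_cube" "x + v b \<in> unit_cube" for x a b
    proof
      fix j
      from that have "0 \<le> x $ j - a j" "x $ j - a j < 1" "0 \<le> x $ j - b j" "x $ j - b j < 1"
        by (auto simp: unit_cube_def v_def)
      then show "a j = b j" by linarith
    qed
    then show ?thesis by (fastforce simp: disjoint_family_on_def)
  qed
  have "ennreal (real n ^ CARD('k)) * emeasure lborel ({x. real n *\<^sub>R x \<in> F} \<inter> unit_cube)
      = emeasure lborel B"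
    using B n by (subst emeasure_lborel_scale[of B "real n"]) (auto simp: B_iff Collect_conj_eq)
  also have "\<dots> = (\<Sum>a\<in>?A. emeasure lborel (F \<inter> {x. x + v a \<in> unit_cube}))"
    unfolding B_def using meas disj finite_grid
    by (intro sum_emeasure[symmetric]) auto
  also have "\<dots> = (\<Sum>a\<in>?A. emeasure lborel (F \<inter> unit_cube))"
    using F by (intro sum.cong refl emeasure_fundamental_domain fundamental_domain_translate
        fundamental_domain_unit_cube)
  also have "\<dots> = ennreal (real n ^ CARD('k)) * emeasure lborel (F \<inter> unit_cube)"
    by (simp add: card_grid ennreal_of_nat_eq_real_of_nat)
  finally show ?thesis using n by (subst (asm) ennreal_mult_cancel_left) auto
qed

lemma emeasure_unit_cube_finite: "emeasure lborel (F \<inter> unit_cube) < \<infinity>"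
proof -
  have "F \<inter> unit_cube \<subseteq> cbox 0 (\<chi> j. 1)" by (auto simp: unit_cube_def mem_box_cart less_imp_le)
  then have "emeasure lborel (F \<inter> unit_cube) \<le> emeasure lborel (cbox 0 (\<chi> j. 1) :: (real ^ 'a) set)"
    by (intro emeasure_mono) auto
  then show ?thesis using emeasure_lborel_cbox_finite le_less_trans by blast
qed

section \<open>Lattice points in star-shaped sets\<close>

lemma card_int_interval_le:
  fixes x r :: real
  assumes "0 \<le> r"
  shows "finite {q :: int. \<bar>x + of_int q\<bar> < r}"
    and "real (card {q :: int. \<bar>x + of_int q\<bar> < r}) \<le> 2 * r + 1"
proof -
  let ?J = "{q :: int. \<bar>x + of_int q\<bar> < r}"
  have sub: "?J \<subseteq> {\<lceil>- x - r\<rceil>..\<lfloor>- x + r\<rfloor>}"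
    by (auto simp: ceiling_le_iff le_floor_iff)
  then show "finite ?J" by (rule finite_subset) simp
  from sub have "card ?J \<le> card {\<lceil>- x - r\<rceil>..\<lfloor>- x + r\<rfloor>}" by (intro card_mono) auto
  also have "\<dots> = nat (\<lfloor>- x + r\<rfloor> + 1 - \<lceil>- x - r\<rceil>)" by simp
  finally have "real (card ?J) \<le> real (nat (\<lfloor>- x + r\<rfloor> + 1 - \<lceil>- x - r\<rceil>))" by linarith
  also have "\<dots> \<le> 2 * r + 1" using assms by linarith
  finally show "real (card ?J) \<le> 2 * r + 1" .
qed

text \<open>A union bound over the coordinate \<open>i\<close> that lies within 1 of its hyperplane:
  at most 3 integers are possible in that coordinate and at most \<open>2 * r + 1\<close> in each of
  the others.\<close>

lemma card_near_hyperplanes_le: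
  fixes u :: "real ^ 'k"
  assumes r: "0 \<le> r"
  shows "finite {q :: 'k \<Rightarrow> int. \<forall>j. \<bar>u $ j + of_int (q j)\<bar> < r}" (is "finite ?Q")
    and "real (card {q :: 'k \<Rightarrow> int. (\<exists>j. \<bar>u $ j + of_int (q j)\<bar> < 1) \<and> (\<forall>j. \<bar>u $ j + of_int (q j)\<bar> < r)})
      \<le> 3 * real CARD('k) * (2 * r + 1) ^ (CARD('k) - 1)" (is "real (card ?N) \<le> _")
proof -
  let ?J = "\<lambda>s j. {q :: int. \<bar>u $ j + of_int q\<bar> < s}"
  define P where "P i = (\<Pi>\<^sub>E j\<in>UNIV. if j = i then ?J 1 j else ?J r j)" for i
  have "?Q = (\<Pi>\<^sub>E j\<in>UNIV. ?J r j)" by (auto simp: PiE_def)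
  moreover have "finite \<dots>" using card_int_interval_le(1)[OF r] by (intro finite_PiE) auto
  ultimately show "finite ?Q" by simp
  have fin: "finite (P i)" for i
    unfolding P_def using card_int_interval_le(1)[OF r] card_int_interval_le(1)[of 1] by (intro finite_PiE) auto
  have card: "real (card (P i)) \<le> 3 * (2 * r + 1) ^ (CARD('k) - 1)" for i
  proof -
    have "real (card (P i)) = (\<Prod>j\<in>UNIV. real (card (if j = i then ?J 1 j else ?J r j)))"
      by (simp add: P_def card_PiE)
    also have "\<dots> \<le> (\<Prod>j\<in>UNIV. if j = i then 3 else 2 * r + 1)"
      using card_int_interval_le(2)[OF r] card_int_interval_le(2)[of 1]
      by (intro prod_mono) auto
    also have "\<dots> = 3 * (2 * r + 1) ^ (CARD('k) - 1)"
      by (subst prod.remove[of _ i]) (auto simp: card_Diff_singleton)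
    finally show ?thesis .
  qed
  have "?N \<subseteq> (\<Union>i\<in>UNIV. P i)"
  proof
    fix q assume q: "q \<in> ?N"
    then obtain i where i: "\<bar>u $ i + of_int (q i)\<bar> < 1" by blast
    have "q \<in> P i" unfolding P_def using q i by (intro PiE_I) simp_all
    then show "q \<in> (\<Union>i\<in>UNIV. P i)" by blast
  qed
  then have "card ?N \<le> card (\<Union>i\<in>UNIV. P i)" using fin by (intro card_mono) auto
  also have "\<dots> \<le> (\<Sum>i\<in>UNIV. card (P i))" by (rule card_UN_le) simp
  finally have "real (card ?N) \<le> real (\<Sum>i\<in>UNIV. card (P i))" by (rule of_nat_mono)
  also have "\<dots> = (\<Sum>i\<in>UNIV. real (card (P i)))" by (rule of_nat_sum)
  also have "\<dots> \<le> (\<Sum>i::'k\<in>UNIV. 3 * (2 * r + 1) ^ (CARD('k) - 1))"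
    by (intro sum_mono card)
  finally show "real (card ?N) \<le> 3 * real CARD('k) * (2 * r + 1) ^ (CARD('k) - 1)"
    by (simp add: mult_ac)
qed

lemma fmeasurable_lborel_bounded:
  assumes "bounded S" "S \<in> sets borel" shows "S \<in> fmeasurable lborel"
  using emeasure_bounded_finite[OF assms(1)] assms by (auto simp: fmeasurable_def)

text \<open>A lattice point of \<open>S\<close> all of whose coordinates are at least \<open>1 / N\<close> in modulus owns the
  cell of side \<open>1 / N\<close> that touches it from the side of the origin; star-shapedness puts this cell
  inside \<open>S\<close>, so the volume of \<open>S\<close> bounds the number of such points.\<close>

lemma card_lattice_star_shaped_le:
  fixes S :: "(real ^ 'k) set" and w :: "real ^ 'k" and N :: nat
  defines "G \<equiv> {q :: 'k \<Rightarrow> int. (\<chi> j. w $ j + of_int (q j) / real N) \<in> S}"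
  assumes N: "0 < N" and S: "S \<in> sets borel" "strongly_star_shaped S"
    and \<rho>: "0 \<le> \<rho>" "\<And>x j. x \<in> S \<Longrightarrow> \<bar>x $ j\<bar> < \<rho>"
  shows "finite G"
    and "real (card G) \<le> real N ^ CARD('k) * measure lborel S
      + 3 * real CARD('k) * (2 * (real N * \<rho>) + 1) ^ (CARD('k) - 1)"
proof -
  \<comment> \<open>Counting is done after multiplication by \<open>N\<close>: the points become
    \<open>u + q\<close> with integral \<open>q\<close>, and the half-width \<open>\<rho>\<close>
    becomes \<open>r\<close>.\<close>
  define r where "r = real N * \<rho>"
  define u where "u = real N *\<^sub>R w"
  have r: "0 \<le> r" using \<rho> by (simp add: r_def)
  define t where "t q = (\<chi> j. w $ j + of_int (q j) / real N)" for q :: "'k \<Rightarrow> int"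
  have ut: "u $ j + of_int (q j) = real N * t q $ j" for q j
    using N by (simp add: u_def t_def field_simps)
  have G: "q \<in> G \<longleftrightarrow> t q \<in> S" for q by (simp add: G_def t_def)
  have Gr: "\<bar>u $ j + of_int (q j)\<bar> < r" if "q \<in> G" for q j
    using \<rho>(2)[of "t q" j] that N by (simp add: ut r_def abs_mult G)
  then have "G \<subseteq> {q. \<forall>j. \<bar>u $ j + of_int (q j)\<bar> < r}" by auto
  then show finG: "finite G" using card_near_hyperplanes_le(1)[OF r] by (rule finite_subset)
  define G1 where "G1 = {q \<in> G. \<forall>j. 1 \<le> \<bar>u $ j + of_int (q j)\<bar>}"
  \<comment> \<open>A positive coordinate of \<open>t q\<close> is the upper end of the
    corresponding side of the cell, any other coordinate the lower end, so that the cell lies on the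
    side of the origin.\<close>
  define lo where "lo q = (\<chi> j. t q $ j - (if 0 < t q $ j then 1 / real N else 0))" for q
  define hi where "hi q = (\<chi> j. lo q $ j + 1 / real N)" for q
  have far: "1 / real N \<le> \<bar>t q $ j\<bar>" if "q \<in> G1" for q j
  proof -
    have "1 \<le> \<bar>real N * t q $ j\<bar>" using that by (auto simp: G1_def ut)
    then show ?thesis using N by (simp add: abs_mult field_simps)
  qed
  \<comment> \<open>Since \<open>t q\<close> is at least \<open>1 / N\<close> away from every
    coordinate hyperplane, the open cell crosses none of them, and its points share the signs of
    \<open>t q\<close>.\<close>
  have cell: "(if 0 < t q $ j then 0 < x $ j \<and> t q $ j - 1 / real N < x $ j \<and> x $ j < t q $ j
        else x $ j < 0 \<and> t q $ j < x $ j \<and> x $ j < t q $ j + 1 / real N)"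
    if "q \<in> G1" "x \<in> box (lo q) (hi q)" for q x j
  proof -
    have "lo q $ j < x $ j" "x $ j < hi q $ j" using that(2) by (auto simp: mem_box_cart)
    then show ?thesis using far[OF that(1), of j] by (auto simp: lo_def hi_def)
  qed
  have sub: "box (lo q) (hi q) \<subseteq> S" if q: "q \<in> G1" for q
  proof
    fix x assume x: "x \<in> box (lo q) (hi q)"
    have "\<bar>x $ j\<bar> \<le> \<bar>t q $ j\<bar>" for j using cell[OF q x, of j] by (auto split: if_splits)
    moreover have "t q \<in> S" using q by (auto simp: G1_def G)
    ultimately show "x \<in> S" using S(2) by (auto simp: strongly_star_shaped_def)
  qed
  have "disjoint_family_on (\<lambda>q. box (lo q) (hi q)) G1"
  proof -
    have "q = p" if q: "q \<in> G1" "x \<in> box (lo q) (hi q)" and p: "p \<in> G1" "x \<in> box (lo p) (hi p)" for q p x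
    proof
      fix j
      \<comment> \<open>The sign of \<open>x $ j\<close> selects the same case of
        \<open>cell\<close> for \<open>q\<close> and for \<open>p\<close>, so both coordinates lie
        in one open interval of length \<open>1 / N\<close>.\<close>
      have "\<bar>t q $ j - t p $ j\<bar> < 1 / real N"
        using cell[OF q, of j] cell[OF p, of j] by (auto split: if_splits)
      then have "real N * \<bar>t q $ j - t p $ j\<bar> < 1"
        using N by (simp add: field_simps)
      then have "\<bar>real N * t q $ j - real N * t p $ j\<bar> < 1"
        by (simp add: abs_mult flip: right_diff_distrib)
      then have "\<bar>real_of_int (q j) - real_of_int (p j)\<bar> < 1"
        by (simp flip: ut)
      then show "q j = p j" by linarith
    qed
    then show ?thesis by (fastforce simp: disjoint_family_on_def)
  qed
  moreover have cell_vol: "measure lborel (box (lo q) (hi q)) = (1 / real N) ^ CARD('k)" for q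
  proof -
    have "cbox (lo q) (hi q) \<noteq> {}" by (auto simp: interval_ne_empty_cart hi_def)
    then have "measure lborel (cbox (lo q) (hi q)) = (1 / real N) ^ CARD('k)"
      by (simp add: content_cbox_cart hi_def)
    then show ?thesis by (simp add: measure_lborel_box_eq measure_lborel_cbox_eq)
  qed
  moreover have finG1: "finite G1" using finG by (simp add: G1_def)
  ultimately have "real (card G1) * (1 / real N) ^ CARD('k) = measure lborel (\<Union>q\<in>G1. box (lo q) (hi q))"
    by (subst measure_finite_Union) (auto simp: emeasure_lborel_box_eq)
  also have "\<dots> \<le> measure lborel S"
  proof (rule measure_mono_fmeasurable)
    have "S \<subseteq> box (\<chi> j. - \<rho>) (\<chi> j. \<rho>)"
      using \<rho>(2) by (auto simp: mem_box_cart abs_less_iff minus_less_iff)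
    then have "bounded S" using bounded_box bounded_subset by blast
    then show "S \<in> fmeasurable lborel" using S(1) by (rule fmeasurable_lborel_bounded)
  qed (use sub in \<open>auto intro!: borel_open\<close>)
  finally have G1: "real (card G1) \<le> real N ^ CARD('k) * measure lborel S"
    using N by (simp add: field_simps power_divide)
  let ?N = "{q :: 'k \<Rightarrow> int. (\<exists>j. \<bar>u $ j + of_int (q j)\<bar> < 1) \<and> (\<forall>j. \<bar>u $ j + of_int (q j)\<bar> < r)}"
  \<comment> \<open>A point of \<open>G\<close> outside \<open>G1\<close> has, after rescaling, a
    coordinate of modulus below 1 and is therefore counted in \<open>?N\<close>.\<close>
  have "G \<subseteq> G1 \<union> ?N" using Gr by (auto simp: G1_def not_less[symmetric])
  moreover have finN: "finite ?N" using card_near_hyperplanes_le(1)[OF r, of u] by (rule finite_subset[rotated]) auto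
  ultimately have "card G \<le> card G1 + card ?N"
    using finG1 by (meson card_Un_le card_mono finite_UnI le_trans)
  then show "real (card G) \<le> real N ^ CARD('k) * measure lborel S
      + 3 * real CARD('k) * (2 * (real N * \<rho>) + 1) ^ (CARD('k) - 1)"
    using G1 card_near_hyperplanes_le(2)[OF r, of u] by (simp add: r_def)
qed

section \<open>Averaging over torsion translates\<close>

text \<open>Double counting: the left-hand sum is the integral over \<open>D\<close> of the number
  of sets \<open>E a\<close> containing a given point, and \<open>m\<close> bounds this number
  pointwise.\<close>

lemma sum_measure_le:
  assumes "finite A" "D \<in> fmeasurable M" and E: "\<And>a. a \<in> A \<Longrightarrow> E a \<in> sets M" "\<And>a. a \<in> A \<Longrightarrow> E a \<subseteq> D"
    and m: "\<And>x. x \<in> D \<Longrightarrow> real (card {a \<in> A. x \<in> E a}) \<le> m"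
  shows "(\<Sum>a\<in>A. measure M (E a)) \<le> m * measure M D"
proof -
  have fE: "E a \<in> fmeasurable M" if "a \<in> A" for a
    using assms(2) E that by (meson fmeasurableI2)
  have int: "integrable M (indicat_real B)" if "B \<in> fmeasurable M" for B
    using that by (simp add: fmeasurable_def)
  have ind: "measure M B = (\<integral>x. indicat_real B x \<partial>M)" if "B \<in> fmeasurable M" for B
    using that by (simp add: fmeasurable_def sets.Int_space_eq2)
  have "(\<Sum>a\<in>A. measure M (E a)) = (\<Sum>a\<in>A. \<integral>x. indicat_real (E a) x \<partial>M)"
    using fE ind by (intro sum.cong) auto
  also have "\<dots> = (\<integral>x. (\<Sum>a\<in>A. indicat_real (E a) x) \<partial>M)"
    using fE int by (intro Bochner_Integration.integral_sum[symmetric]) blast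
  also have "\<dots> \<le> (\<integral>x. m * indicat_real D x \<partial>M)"
  proof (rule integral_mono)
    show "integrable M (\<lambda>x. \<Sum>a\<in>A. indicat_real (E a) x)"
      using fE int by (intro Bochner_Integration.integrable_sum) blast
    show "integrable M (\<lambda>x. m * indicat_real D x)"
      using int[OF assms(2)] by simp
    fix x
    have eq: "(\<Sum>a\<in>A. indicat_real (E a) x) = real (card {a \<in> A. x \<in> E a})"
      using assms(1) by (simp add: indicator_def sum.If_cases Int_def)
    show "(\<Sum>a\<in>A. indicat_real (E a) x) \<le> m * indicat_real D x"
    proof (cases "x \<in> D")
      case False
      then have none: "{a \<in> A. x \<in> E a} = {}" using E(2) by blast
      show ?thesis using False unfolding eq none by simp
    qed (use m eq in simp)
  qed
  also have "\<dots> = m * measure M D" using ind[OF assms(2)] by simp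
  finally show ?thesis .
qed

text \<open>Modulo the lattice, the points \<open>n' a / n\<close> are the torsion points of order \<open>N = n / gcd n n'\<close>, and
  each of them arises from \<open>gcd n n'\<close> residues in every coordinate.\<close>

lemma card_torsion_points_le:
  fixes S :: "(real ^ 'k) set" and w :: "real ^ 'k" and n n' :: nat
  defines "G \<equiv> {q :: 'k \<Rightarrow> int. (\<chi> j. w $ j + of_int (q j) / real (n div gcd n n')) \<in> S}"
  assumes n: "0 < n" "0 < n'" and finG: "finite G"
  shows "card {a :: 'k \<Rightarrow> int. (\<forall>j. 0 \<le> a j \<and> a j < int n) \<and>
      (\<chi> j. w $ j + real n' * of_int (a j) / real n) \<in> periodize S} \<le> card G * gcd n n' ^ CARD('k)"
    (is "card ?A \<le> _")
proof -
  define g where "g = gcd n n'"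
  define N where "N = n div g"
  define N' where "N' = n' div g"
  have g: "0 < g" "n = N * g" "n' = N' * g" using n by (auto simp: g_def N_def N'_def)
  have N: "0 < N" using n g by (cases N) auto
  have cop: "coprime (int N) (int N')"
    unfolding N_def N'_def g_def coprime_int_iff using n div_gcd_coprime by blast
  have "\<forall>a\<in>?A. \<exists>z. (\<chi> j. w $ j + real n' * of_int (a j) / real n - of_int (z j :: int)) \<in> S"
  proof
    fix a assume "a \<in> ?A"
    then obtain z where "(\<chi> j. w $ j + real n' * of_int (a j) / real n) - (\<chi> j. of_int (z j)) \<in> S"
      unfolding periodize_iff int_lattice_eq_range by blast
    then show "\<exists>z. (\<chi> j. w $ j + real n' * of_int (a j) / real n - of_int (z j :: int)) \<in> S"
      by (auto simp: minus_vec_def intro!: exI[of _ z])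
  qed
  from bchoice[OF this] obtain z :: "('k \<Rightarrow> int) \<Rightarrow> 'k \<Rightarrow> int" where
    z: "\<forall>a\<in>?A. (\<chi> j. w $ j + real n' * of_int (a j) / real n - of_int (z a j)) \<in> S"
    by blast
  \<comment> \<open>\<open>z a\<close> brings the point back into \<open>S\<close>. Since
    \<open>n' a / n - z = (N' a - N z) / N\<close>, the value \<open>q a\<close> is the numerator
    over the reduced denominator \<open>N\<close>.\<close>
  define q where "q a = (\<lambda>j. int N' * a j - int N * z a j)" for a
  let ?f = "\<lambda>a. (q a, \<lambda>j. a j div int N)"
  have "?f ` ?A \<subseteq> G \<times> {b. \<forall>j. 0 \<le> b j \<and> b j < int g}"
  proof (rule image_subsetI)
    fix a assume a: "a \<in> ?A"
    have "real n' * of_int (a j) / real n - of_int (z a j) = of_int (q a j) / real N" for j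
      using g N by (simp add: q_def field_simps)
    then have "q a \<in> G" using z[rule_format, OF a] by (simp add: add_diff_eq[symmetric] N_def g_def G_def)
    moreover have "0 \<le> a j div int N \<and> a j div int N < int g" for j
    proof -
      have "0 \<le> a j" "a j < int N * int g" using a g(2) by auto
      moreover have "int N * (a j div int N) \<le> a j"
        using N by (simp add: minus_mod_eq_mult_div[symmetric])
      ultimately have "int N * (a j div int N) < int N * int g" by linarith
      with \<open>0 \<le> a j\<close> show ?thesis using N by (simp add: pos_imp_zdiv_nonneg_iff)
    qed
    ultimately show "?f a \<in> G \<times> {b. \<forall>j. 0 \<le> b j \<and> b j < int g}" by simp
  qed
  \<comment> \<open>As \<open>N'\<close> is invertible modulo \<open>N\<close>, \<open>q a\<close>
    determines \<open>a\<close> modulo \<open>N\<close>; the quotient by \<open>N\<close> supplies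
    the rest.\<close>
  moreover have "inj_on ?f ?A"
  proof (rule inj_onI, rule ext)
    fix a b j assume "?f a = ?f b"
    then have "q a j = q b j" and d: "a j div int N = b j div int N" by (auto dest: fun_cong)
    then have "int N' * (a j - b j) = int N * (z a j - z b j)" by (simp add: q_def algebra_simps)
    then have "int N dvd int N' * (a j - b j)" by simp
    then have "int N dvd a j - b j" using cop by (simp add: coprime_dvd_mult_right_iff)
    then have "a j mod int N = b j mod int N" by (simp add: mod_eq_dvd_iff)
    with d show "a j = b j" by (metis div_mult_mod_eq)
  qed
  moreover have "finite (G \<times> {b :: 'k \<Rightarrow> int. \<forall>j. 0 \<le> b j \<and> b j < int g})"
    using finG finite_grid by blast
  ultimately have "card ?A \<le> card (G \<times> {b :: 'k \<Rightarrow> int. \<forall>j. 0 \<le> b j \<and> b j < int g})"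
    by (intro card_inj_on_le)
  then show ?thesis by (simp add: card_cartesian_product card_grid g_def)
qed

text \<open>A half-width below \<open>1 / 2\<close> puts \<open>S\<close> inside the centred unit
  cube \<open>?D\<close>, in which periodization adds no further points. Dilation invariance and the
  change of fundamental domain from \<open>?D\<close> to \<open>unit_cube\<close> do the
  rest.\<close>

lemma measure_torus_star_shaped:
  fixes S :: "(real ^ 'k) set"
  assumes S: "S \<in> sets borel" "\<And>x j. x \<in> S \<Longrightarrow> \<bar>x $ j\<bar> < 1 / 2" and n: "0 < n"
  shows "measure lborel ({x. real n *\<^sub>R x \<in> periodize S} \<inter> unit_cube) = measure lborel S"
proof -
  let ?D = "{x :: real ^ 'k. \<forall>j. - (1/2) \<le> x $ j \<and> x $ j < - (1/2) + 1}"
  have "periodize S \<inter> ?D = S"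
  proof (intro equalityI subsetI)
    fix x assume x: "x \<in> periodize S \<inter> ?D"
    then obtain q where q: "q \<in> int_lattice" "x - q \<in> S" by (auto simp: periodize_iff)
    have "\<exists>!q. q \<in> int_lattice \<and> x - q \<in> ?D"
      using fundamental_domain_half_open[of "- (1/2)"] unfolding fundamental_domain_def by blast
    moreover have "x - q \<in> ?D"
    proof -
      have "- (1/2) \<le> (x - q) $ j \<and> (x - q) $ j < - (1/2) + 1" for j
        using S(2)[OF q(2), of j] by linarith
      then show ?thesis by blast
    qed
    moreover have "x - 0 \<in> ?D" using x by simp
    ultimately have "q = 0" using q(1) int_lattice_0 by blast
    then show "x \<in> S" using q by simp
  next
    fix x assume x: "x \<in> S"
    then have "x \<in> periodize S" unfolding periodize_iff by (intro bexI[of _ 0]) auto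
    moreover have "- (1/2) \<le> x $ j \<and> x $ j < - (1/2) + 1" for j using S(2)[OF x, of j] by linarith
    ultimately show "x \<in> periodize S \<inter> ?D" by blast
  qed
  then have "emeasure lborel (periodize S \<inter> unit_cube) = emeasure lborel S"
    using emeasure_fundamental_domain[OF periodic_periodize borel_periodize[OF S(1)]
        fundamental_domain_half_open[of "- (1/2)"] fundamental_domain_unit_cube] by simp
  then show ?thesis
    using emeasure_torus_scale[OF periodic_periodize borel_periodize[OF S(1)] n] by (simp add: measure_def)
qed

lemma measure_torus_translate:
  assumes "periodic F" "F \<in> sets borel"
  shows "measure lborel ({x. x + v \<in> F} \<inter> unit_cube) = measure lborel (F \<inter> unit_cube)"
  using emeasure_torus_translate[OF assms] by (simp add: measure_def)

text \<open>The asymmetric half of the estimate: the geometry sits in the second set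
  \<open>P'\<close>, while \<open>P\<close> enters through its invariance under translation by
  \<open>a / n\<close> and through its measure. When both sets have the shape required of
  \<open>P'\<close>, exchanging their roles gives the other term of the minimum.\<close>

lemma measure_overlap_le:
  fixes S F :: "(real ^ 'k) set" and \<gamma> :: "real ^ 'k" and n n' :: nat
  defines "P' \<equiv> {x. real n' *\<^sub>R x \<in> periodize S}" and "P \<equiv> {x. real n *\<^sub>R x \<in> F}"
  assumes n: "0 < n" "0 < n'" and F: "periodic F" "F \<in> sets borel"
    and S: "S \<in> sets borel" "strongly_star_shaped S" "\<And>x j. x \<in> S \<Longrightarrow> \<bar>x $ j\<bar> < 1 / 2"
    and \<rho>: "0 \<le> \<rho>" "\<And>x j. x \<in> S \<Longrightarrow> \<bar>x $ j\<bar> < \<rho>"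
  shows "measure lborel (P \<inter> {x. x + \<gamma> \<in> P'} \<inter> unit_cube)
    \<le> measure lborel (P \<inter> unit_cube) * measure lborel (P' \<inter> unit_cube)
      + 3 * real CARD('k) * (measure lborel (P \<inter> unit_cube) / real n ^ CARD('k) * real (gcd n n') ^ CARD('k)
          * (2 * \<rho> * real n / real (gcd n n') + 1) ^ (CARD('k) - 1))"
proof -
  define g where "g = gcd n n'"
  define N where "N = n div g"
  have g: "0 < g" "n = N * g" using n by (auto simp: g_def N_def)
  have N: "0 < N" using n g by (cases N) auto
  let ?A = "{a :: 'k \<Rightarrow> int. \<forall>j. 0 \<le> a j \<and> a j < int n}"
  define v where "v a = (\<chi> j. of_int (a j) / real n)" for a :: "'k \<Rightarrow> int"
  define E where "E = 3 * real CARD('k) * (2 * (real N * \<rho>) + 1) ^ (CARD('k) - 1)"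
  \<comment> \<open>A pointwise bound for the number of \<open>a\<close>: the volume term and the
    hyperplane error \<open>E\<close> for the lattice of mesh \<open>1 / N\<close>, times the at
    most \<open>g ^ CARD('k)\<close> vectors \<open>a\<close> that share one lattice point.\<close>
  define m where "m = (real N ^ CARD('k) * measure lborel S + E) * real g ^ CARD('k)"
  let ?I = "P \<inter> {x. x + \<gamma> \<in> P'}"
  have P: "periodic P" "P \<in> sets borel"
    unfolding P_def using F by (auto intro: periodic_scale borel_scale)
  have P': "periodic P'" "P' \<in> sets borel"
    unfolding P'_def using S(1) by (auto intro: periodic_scale borel_scale periodic_periodize borel_periodize)
  have I: "periodic ?I" "?I \<in> sets borel"
    using P P' by (auto intro!: periodic_Int periodic_translate borel_translate)
  have v: "x + v a \<in> P \<longleftrightarrow> x \<in> P" for x a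
  proof -
    have "real n *\<^sub>R (x + v a) = real n *\<^sub>R x + (\<chi> j. of_int (a j))"
      using n by (simp add: vec_eq_iff v_def field_simps)
    then show ?thesis using F(1) by (simp add: P_def periodic_def)
  qed
  \<comment> \<open>Translation by \<open>v a\<close> preserves \<open>P\<close> and the torus
    measure, so the overlap can be averaged over all \<open>a\<close> with only \<open>P'\<close>
    displaced.\<close>
  have "real n ^ CARD('k) * measure lborel (?I \<inter> unit_cube) = (\<Sum>a\<in>?A. measure lborel (?I \<inter> unit_cube))"
    by (simp add: card_grid)
  also have "\<dots> = (\<Sum>a\<in>?A. measure lborel (P \<inter> {x. x + (v a + \<gamma>) \<in> P'} \<inter> unit_cube))"
  proof (rule sum.cong[OF refl])
    fix a
    have "P \<inter> {x. x + (v a + \<gamma>) \<in> P'} = {x. x + v a \<in> ?I}" by (auto simp: v add.assoc)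
    then show "measure lborel (?I \<inter> unit_cube) = measure lborel (P \<inter> {x. x + (v a + \<gamma>) \<in> P'} \<inter> unit_cube)"
      using measure_torus_translate[OF I, of "v a"] by simp
  qed
  also have "\<dots> \<le> m * measure lborel (P \<inter> unit_cube)"
  proof (rule sum_measure_le)
    show "finite ?A" by (rule finite_grid)
    show "P \<inter> unit_cube \<in> fmeasurable lborel"
      using P emeasure_unit_cube_finite[of P] by (simp add: fmeasurable_def sets.Int)
    show "P \<inter> {x. x + (v a + \<gamma>) \<in> P'} \<inter> unit_cube \<in> sets lborel" for a
      using P P' by (auto intro!: borel_translate)
    fix x
    \<comment> \<open>For fixed \<open>x\<close>, membership in the displaced \<open>P'\<close> is
      read off after multiplication by \<open>n'\<close>, where the translation by
      \<open>v a\<close> becomes one by \<open>n' a / n\<close>.\<close>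
    define w where "w = real n' *\<^sub>R (x + \<gamma>)"
    let ?G = "{q :: 'k \<Rightarrow> int. (\<chi> j. w $ j + of_int (q j) / real (n div gcd n n')) \<in> S}"
    have G: "finite ?G" "real (card ?G) \<le> real N ^ CARD('k) * measure lborel S + E"
      using card_lattice_star_shaped_le[OF N S(1,2) \<rho>, of w] by (auto simp: N_def g_def E_def)
    have "x + (v a + \<gamma>) \<in> P' \<longleftrightarrow> (\<chi> j. w $ j + real n' * of_int (a j) / real n) \<in> periodize S" for a
    proof -
      have "real n' *\<^sub>R (x + (v a + \<gamma>)) = (\<chi> j. w $ j + real n' * of_int (a j) / real n)"
        by (simp add: vec_eq_iff v_def w_def algebra_simps)
      then show ?thesis by (simp add: P'_def)
    qed
    then have "{a \<in> ?A. x \<in> P \<inter> {x. x + (v a + \<gamma>) \<in> P'} \<inter> unit_cube}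
        \<subseteq> {a \<in> ?A. (\<chi> j. w $ j + real n' * of_int (a j) / real n) \<in> periodize S}" by auto
    then have "card {a \<in> ?A. x \<in> P \<inter> {x. x + (v a + \<gamma>) \<in> P'} \<inter> unit_cube}
        \<le> card {a \<in> ?A. (\<chi> j. w $ j + real n' * of_int (a j) / real n) \<in> periodize S}"
      by (intro card_mono finite_subset[OF _ finite_grid]) auto
    also have "\<dots> \<le> card ?G * g ^ CARD('k)"
      using card_torsion_points_le[OF n G(1)] by (simp add: g_def)
    finally have "real (card {a \<in> ?A. x \<in> P \<inter> {x. x + (v a + \<gamma>) \<in> P'} \<inter> unit_cube})
        \<le> real (card ?G * g ^ CARD('k))"
      by (rule of_nat_mono)
    also have "\<dots> = real (card ?G) * real g ^ CARD('k)"
      by (simp only: of_nat_mult of_nat_power)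
    also have "\<dots> \<le> m" unfolding m_def using G(2) by (intro mult_right_mono) auto
    finally show "real (card {a \<in> ?A. x \<in> P \<inter> {x. x + (v a + \<gamma>) \<in> P'} \<inter> unit_cube}) \<le> m" .
  qed auto
  finally have "measure lborel (?I \<inter> unit_cube) \<le> m * measure lborel (P \<inter> unit_cube) / real n ^ CARD('k)"
    using n by (simp add: field_simps)
  \<comment> \<open>By \<open>n = N * g\<close> the volume term acquires the factor
    \<open>n ^ CARD('k)\<close>, which cancels the number of averaged translations.\<close>
  also have "m = real n ^ CARD('k) * measure lborel S + E * real g ^ CARD('k)"
    by (simp add: m_def g(2) algebra_simps power_mult_distrib)
  also have "measure lborel S = measure lborel (P' \<inter> unit_cube)"
    unfolding P'_def using measure_torus_star_shaped[OF S(1,3) n(2)] by simp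
  finally have "measure lborel (?I \<inter> unit_cube)
    \<le> (real n ^ CARD('k) * measure lborel (P' \<inter> unit_cube) + E * real g ^ CARD('k))
      * measure lborel (P \<inter> unit_cube) / real n ^ CARD('k)" .
  also have "\<dots> = measure lborel (P \<inter> unit_cube) * measure lborel (P' \<inter> unit_cube)
      + E * (measure lborel (P \<inter> unit_cube) / real n ^ CARD('k) * real g ^ CARD('k))"
    using n by (simp add: field_simps)
  also have "E = 3 * real CARD('k) * (2 * \<rho> * real n / real g + 1) ^ (CARD('k) - 1)"
    using g by (simp add: E_def mult_ac)
  finally show ?thesis by (simp add: g_def mult_ac)
qed

section \<open>Admissible sets as preimages of star-shaped sets\<close>

lemma torus_measure_lborel:
  assumes "periodize S \<in> sets borel"
  shows "torus_measure S = measure lborel (periodize S \<inter> unit_cube)"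
  using assms by (simp add: torus_measure_def unit_cube_def[symmetric] sets.Int)

lemma int_dist_add_of_int: "int_dist (t + of_int a) = int_dist t"
proof -
  have "\<lfloor>t + of_int a + 1 / 2\<rfloor> = \<lfloor>t + 1 / 2\<rfloor> + a" by linarith
  then show ?thesis by (simp add: int_dist_def round_def)
qed

lemma int_dist_eq:
  assumes "\<bar>t - of_int a\<bar> < 1 / 2" shows "int_dist t = \<bar>t - of_int a\<bar>"
  using round_unique'[OF assms] by (simp add: int_dist_def)

text \<open>An integer at distance less than \<open>1 / 2\<close> from a real number is its nearest
  integer. As all \<open>V j\<close> lie below \<open>1 / 2\<close>, the condition on
  \<open>int_dist\<close> says that \<open>n x\<close> differs by a lattice vector from a point
  whose coordinates have moduli in the \<open>V j\<close>.\<close>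

lemma periodize_approx_set:
  fixes V :: "'k::finite \<Rightarrow> real set"
  assumes V: "\<And>j. V j \<subseteq> {..<1 / 2}"
  shows "periodize (approx_set n 0 V) = {x. real n *\<^sub>R x \<in> periodize {y. \<forall>j. \<bar>y $ j\<bar> \<in> V j}}"
proof (intro equalityI subsetI)
  fix x assume "x \<in> periodize (approx_set n 0 V)"
  then obtain f where f: "x - (\<chi> j. of_int (f j)) \<in> approx_set n 0 V"
    by (auto simp: periodize_iff int_lattice_eq_range)
  have "int_dist (real n * x $ j) \<in> V j" for j
  proof -
    have "int_dist (real n * x $ j + of_int (- int n * f j)) \<in> V j"
      using f by (simp add: approx_set_def algebra_simps)
    then show ?thesis by (simp only: int_dist_add_of_int)
  qed
  then have "real n *\<^sub>R x - (\<chi> j. of_int (round (real n * x $ j))) \<in> {y. \<forall>j. \<bar>y $ j\<bar> \<in> V j}"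
    by (simp add: int_dist_def)
  then show "x \<in> {x. real n *\<^sub>R x \<in> periodize {y. \<forall>j. \<bar>y $ j\<bar> \<in> V j}}"
    unfolding mem_Collect_eq[of x] periodize_iff[of "real n *\<^sub>R x"] by (rule bexI) simp
next
  fix x assume "x \<in> {x. real n *\<^sub>R x \<in> periodize {y. \<forall>j. \<bar>y $ j\<bar> \<in> V j}}"
  then obtain f :: "'k \<Rightarrow> int" where f: "\<And>j. \<bar>real n * x $ j - of_int (f j)\<bar> \<in> V j"
    by (auto simp: periodize_iff int_lattice_eq_range)
  have d: "int_dist (real n * x $ j) \<in> V j" for j
    using f[of j] V[of j] int_dist_eq[of "real n * x $ j" "f j"] by auto
  \<comment> \<open>Reducing \<open>x\<close> modulo the lattice into the unit cube changes
    \<open>n x\<close> by integers only.\<close>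
  have "int_dist (real n * (x $ j - of_int \<lfloor>x $ j\<rfloor>)) \<in> V j" for j
    using d[of j] int_dist_add_of_int[of "real n * x $ j" "- int n * \<lfloor>x $ j\<rfloor>"]
    by (simp add: algebra_simps)
  moreover have "0 \<le> x $ j - of_int \<lfloor>x $ j\<rfloor> \<and> x $ j - of_int \<lfloor>x $ j\<rfloor> \<le> 1" for j by linarith
  ultimately have "x - (\<chi> j. of_int \<lfloor>x $ j\<rfloor>) \<in> approx_set n 0 V" by (simp add: approx_set_def)
  then show "x \<in> periodize (approx_set n 0 V)"
    unfolding periodize_iff by (rule bexI) simp
qed

lemma periodize_UN: "periodize (\<Union>i\<in>I. S i) = (\<Union>i\<in>I. periodize (S i))"
  by (simp add: set_eq_iff periodize_iff) metis

text \<open>\<open>property_P\<close> supplies some star-shaped \<open>Z\<close>, which has to be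
  compared with the explicit \<open>S\<close>. For \<open>y\<close> in \<open>S\<close>, the vector
  \<open>y\<close> equals \<open>n z + a\<close> with \<open>z\<close> in \<open>Z\<close> and
  integral \<open>a\<close>. Its coordinates are below \<open>1 / 2\<close> in modulus, hence
  smallest in their classes modulo 1, so \<open>n z\<close> dominates \<open>y\<close> and therefore
  \<open>v\<close>. Thus \<open>v / n\<close> lies in \<open>Z\<close> and \<open>v\<close> in
  \<open>periodize S\<close>, and the smallness of \<open>v\<close> excludes a nonzero lattice
  shift.\<close>

lemma star_shaped_of_property_P:
  fixes S A :: "(real ^ 'k) set"
  assumes n: "0 < n" and P: "property_P n 0 A"
    and A: "periodize A = {x. real n *\<^sub>R x \<in> periodize S}"
    and S: "\<And>x j. x \<in> S \<Longrightarrow> \<bar>x $ j\<bar> < 1 / 2"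
  shows "strongly_star_shaped S"
  unfolding strongly_star_shaped_def
proof (intro ballI allI impI)
  fix y v assume y: "y \<in> S" and v: "\<forall>j. \<bar>v $ j\<bar> \<le> \<bar>y $ j\<bar>"
  obtain Z where Z: "strongly_star_shaped Z"
    and AZ: "periodize A = periodize {z + (1 / real n) *\<^sub>R (0 + q) | z q. z \<in> Z \<and> q \<in> int_lattice}"
    using P by (auto simp: property_P_def)
  have "y \<in> periodize S" using y unfolding periodize_iff by (intro bexI[of _ 0]) auto
  then have "(1 / real n) *\<^sub>R y \<in> periodize A" using n by (simp add: A)
  then obtain z q p where z: "z \<in> Z" and q: "q \<in> int_lattice" and p: "p \<in> int_lattice"
    and zqp: "(1 / real n) *\<^sub>R y - p = z + (1 / real n) *\<^sub>R q"
    unfolding AZ periodize_iff by auto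
  have "\<bar>y $ j\<bar> \<le> real n * \<bar>z $ j\<bar>" for j
  proof -
    have "q $ j + real n * p $ j \<in> \<int>"
      using p q by (simp add: int_lattice_def)
    then obtain a where a: "q $ j + real n * p $ j = of_int a" by (auto elim: Ints_cases)
    have "y $ j / real n - p $ j = z $ j + q $ j / real n"
      using arg_cong[OF zqp, of "\<lambda>x. x $ j"] by simp
    then have "real n * z $ j = y $ j - of_int a"
      using n by (simp add: a[symmetric] field_simps)
    then have "real n * \<bar>z $ j\<bar> = \<bar>y $ j - of_int a\<bar>"
      by (metis abs_mult abs_of_nat)
    moreover have "\<bar>y $ j\<bar> \<le> \<bar>y $ j - of_int a\<bar>"
    proof (cases "a = 0")
      case False
      then have "1 \<le> \<bar>real_of_int a\<bar>" by linarith
      then show ?thesis using S[OF y, of j] by linarith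
    qed simp
    ultimately show ?thesis by simp
  qed
  then have "\<bar>v $ j\<bar> \<le> real n * \<bar>z $ j\<bar>" for j using v order_trans by blast
  then have "(1 / real n) *\<^sub>R v \<in> Z"
    using Z z n unfolding strongly_star_shaped_def
    by (auto simp: abs_mult field_simps)
  then have "(1 / real n) *\<^sub>R v - 0 \<in> {z + (1 / real n) *\<^sub>R (0 + q) | z q. z \<in> Z \<and> q \<in> int_lattice}"
    by (intro CollectI exI[of _ "(1 / real n) *\<^sub>R v"] exI[of _ 0]) simp
  then have "(1 / real n) *\<^sub>R v \<in> periodize A"
    unfolding AZ periodize_iff by (rule bexI) simp
  then have "v \<in> periodize S" using n by (simp add: A)
  then obtain f :: "'k \<Rightarrow> int" where f: "v - (\<chi> j. of_int (f j)) \<in> S"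
    by (auto simp: periodize_iff int_lattice_eq_range)
  have "f j = 0" for j
  proof -
    have "\<bar>v $ j - of_int (f j)\<bar> < 1 / 2" using S[OF f, of j] by simp
    moreover have "\<bar>v $ j\<bar> < 1 / 2" using S[OF y, of j] v le_less_trans by blast
    ultimately have "\<bar>real_of_int (f j)\<bar> < 1" by linarith
    then show ?thesis by linarith
  qed
  then have "(\<chi> j. of_int (f j)) = (0 :: real ^ 'k)" by (simp add: vec_eq_iff)
  then show "v \<in> S" using f by simp
qed

lemma ex_dyadic_block: "1 \<le> n \<Longrightarrow> \<exists>m\<ge>1. n \<in> dyadic_block m"
proof -
  assume "1 \<le> n"
  then obtain m where "2 ^ m \<le> n" "n < 2 ^ (m + 1)" using ex_power_ivl1[of 2 n] by auto
  \<comment> \<open>Block \<open>m\<close> starts at \<open>2 ^ (m - 1)\<close>, so the binary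
    exponent \<open>m\<close> of \<open>n\<close> belongs to block \<open>m + 1\<close>.\<close>
  then show ?thesis unfolding dyadic_block_def by (intro exI[of _ "m + 1"]) auto
qed

text \<open>Reduces \<open>A n\<close> to the data of the overlap estimate. The bound
  \<open>1 / (2 * real n)\<close> on the \<open>d m i j\<close> yields half-width
  \<open>1 / 2\<close>, the bound with \<open>C\<close> yields the half-width in terms of
  \<open>\<tau>\<close>, and the half-open \<open>U n i j\<close> make both strict; star-shapedness
  comes from \<open>property_P\<close>.\<close>

lemma admissible_system_star_shaped:
  fixes A :: "nat \<Rightarrow> (real ^ 'k) set"
  assumes adm: "admissible_system \<tau> 0 c C A" and n: "1 \<le> n"
  shows "\<exists>S. S \<in> sets borel \<and> strongly_star_shaped S \<and> (\<forall>x\<in>S. \<forall>j. \<bar>x $ j\<bar> < 1 / 2) \<and>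
    (\<forall>x\<in>S. \<forall>j. \<bar>x $ j\<bar> < real n * (C * real n powr (\<tau> - 1 - 1 / real CARD('k)))) \<and>
    periodize (A n) = {x. real n *\<^sub>R x \<in> periodize S}"
proof -
  obtain m where m: "1 \<le> m" "n \<in> dyadic_block m" using ex_dyadic_block[OF n] by blast
  obtain I :: "nat \<Rightarrow> nat set" and d :: "nat \<Rightarrow> nat \<Rightarrow> 'k \<Rightarrow> real"
    and U :: "nat \<Rightarrow> nat \<Rightarrow> 'k \<Rightarrow> real set" where *: "\<forall>m\<ge>1.
          finite (I m) \<and>
          (\<forall>i\<in>I m. \<forall>j. 0 < d m i j) \<and>
          (\<forall>i\<in>I m. \<forall>j. \<forall>n\<in>dyadic_block m.
             d m i j \<le> 1 / (2 * real n) \<and>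
             c * real n powr (- (1 + 1 / real CARD('k) + \<tau>)) \<le> d m i j \<and>
             d m i j \<le> C * real n powr (- (1 + 1 / real CARD('k) - \<tau>))) \<and>
          (\<forall>i\<in>I m. \<forall>i'\<in>I m. (\<Prod>j\<in>UNIV. d m i j) = (\<Prod>j\<in>UNIV. d m i' j)) \<and>
          (\<forall>n\<in>dyadic_block m.
             (\<forall>i\<in>I m. \<forall>j. U n i j = {0 ..< real n * d m i j} \<or>
                            U n i j = {real n * d m i j / 2 ..< real n * d m i j}) \<and>
             A n = (\<Union>i\<in>I m. approx_set n 0 (U n i)) \<and>
             disjoint_family_on (\<lambda>i. approx_set n 0 (U n i)) (I m) \<and>
             property_P n 0 (A n))"
    using adm unfolding admissible_system_def by (elim conjE exE) (rule that)
  note block = *[THEN spec[of _ m], THEN mp, OF m(1)]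
  note bounds = block[THEN conjunct2, THEN conjunct2, THEN conjunct1]
  note sys = block[THEN conjunct2, THEN conjunct2, THEN conjunct2, THEN conjunct2, THEN bspec, OF m(2)]
  have fin: "finite (I m)" using block by (rule conjunct1)
  have d: "d m i j \<le> 1 / (2 * real n)" "d m i j \<le> C * real n powr (- (1 + 1 / real CARD('k) - \<tau>))"
    if "i \<in> I m" for i j
    using bounds[THEN bspec, OF that, THEN spec[of _ j], THEN bspec, OF m(2)] by simp_all
  have U: "U n i j = {0 ..< real n * d m i j} \<or> U n i j = {real n * d m i j / 2 ..< real n * d m i j}"
    if "i \<in> I m" for i j
    using sys[THEN conjunct1, THEN bspec, OF that, THEN spec[of _ j]] .
  have A: "A n = (\<Union>i\<in>I m. approx_set n 0 (U n i))" and P: "property_P n 0 (A n)"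
    using sys[THEN conjunct2] by - (elim conjE, assumption)+
  have U_sub: "U n i j \<subseteq> {..<real n * d m i j}" if "i \<in> I m" for i j using U[OF that, of j] by auto
  define S where "S = (\<Union>i\<in>I m. {y :: real ^ 'k. \<forall>j. \<bar>y $ j\<bar> \<in> U n i j})"
  have S_less: "\<bar>x $ j\<bar> < real n * e" if x: "x \<in> S" and e: "\<And>i j. i \<in> I m \<Longrightarrow> d m i j \<le> e" for x j e
  proof -
    obtain i where i: "i \<in> I m" "\<bar>x $ j\<bar> \<in> U n i j" using x by (auto simp: S_def)
    then have "\<bar>x $ j\<bar> < real n * d m i j" using U_sub by blast
    also have "\<dots> \<le> real n * e" using e i by (intro mult_left_mono) auto
    finally show ?thesis .
  qed
  have half: "\<bar>x $ j\<bar> < 1 / 2" if "x \<in> S" for x j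
    using S_less[OF that d(1), of j] n by simp
  have V: "U n i j \<subseteq> {..<1 / 2}" if "i \<in> I m" for i j
  proof -
    have "real n * d m i j \<le> 1 / 2" using d(1)[OF that, of j] n by (simp add: field_simps)
    then show ?thesis using U_sub[OF that, of j] by fastforce
  qed
  have per: "periodize (A n) = {x. real n *\<^sub>R x \<in> periodize S}"
    using V by (auto simp: A S_def periodize_UN periodize_approx_set)
  have "{y :: real ^ 'k. \<forall>j. \<bar>y $ j\<bar> \<in> U n i j} \<in> sets borel" if i: "i \<in> I m" for i
  proof -
    have "U n i j \<in> sets borel" for j using U[OF i, of j] by auto
    moreover have "(\<lambda>y :: real ^ 'k. \<bar>y $ j\<bar>) \<in> borel_measurable borel" for j
      by (intro borel_measurable_continuous_onI continuous_intros)
    ultimately have "{y :: real ^ 'k. \<bar>y $ j\<bar> \<in> U n i j} \<in> sets borel" for j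
      using measurable_sets[of "\<lambda>y :: real ^ 'k. \<bar>y $ j\<bar>" borel borel "U n i j"] by (simp add: vimage_def)
    moreover have "{y :: real ^ 'k. \<forall>j. \<bar>y $ j\<bar> \<in> U n i j} = (\<Inter>j. {y. \<bar>y $ j\<bar> \<in> U n i j})" by auto
    ultimately show ?thesis by (simp only:) (intro sets.countable_INT', auto)
  qed
  then have "S \<in> sets borel" unfolding S_def using fin by (intro sets.finite_UN)
  moreover have "strongly_star_shaped S"
    using n by (intro star_shaped_of_property_P[OF _ P per half]) auto
  moreover have "\<bar>x $ j\<bar> < real n * (C * real n powr (\<tau> - 1 - 1 / real CARD('k)))" if "x \<in> S" for x j
    using S_less[OF that d(2), of j] by (simp add: algebra_simps)
  ultimately show ?thesis using half per by (intro exI[of _ S] conjI ballI allI)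
qed

section \<open>The error term and the final estimate\<close>

text \<open>The factor \<open>2 * C + 1\<close> absorbs both the coefficient \<open>2 * C\<close>
  and the summand 1. Adding \<open>e'\<close> enlarges the right-hand side and makes it symmetric in
  the two indices.\<close>

lemma error_term_le:
  fixes C e e' k r X :: real
  assumes "0 \<le> C" "0 \<le> e" "0 \<le> e'" "0 \<le> r" "0 \<le> X" "0 \<le> k"
  shows "3 * k * (X * (2 * (C * e) * r + 1) ^ p) \<le> 3 * k * (2 * C + 1) ^ p * (X * (1 + (e + e') * r) ^ p)"
proof -
  have "2 * (C * e) * r + 1 \<le> (2 * C + 1) * (1 + (e + e') * r)"
    using assms by (simp add: algebra_simps add_nonneg_nonneg)
  then have "(2 * (C * e) * r + 1) ^ p \<le> (2 * C + 1) ^ p * (1 + (e + e') * r) ^ p"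
    using assms by (subst power_mult_distrib[symmetric]) (intro power_mono, auto)
  then have "3 * k * X * (2 * (C * e) * r + 1) ^ p \<le> 3 * k * X * ((2 * C + 1) ^ p * (1 + (e + e') * r) ^ p)"
    using assms by (intro mult_left_mono) auto
  then show ?thesis by (simp add: mult_ac)
qed

theorem mainTheorem12:
  fixes c C :: real
  assumes "0 < c" and "0 < C"
  shows "\<exists>K>0. \<forall>(\<tau>::real) (A :: nat \<Rightarrow> (real ^ 'k) set).
    admissible_system \<tau> 0 c C A \<longrightarrow>
    (\<forall>n\<ge>1. \<forall>n'\<ge>1. \<forall>\<gamma> :: real ^ 'k.
       torus_measure (periodize (A n) \<inter> periodize ((\<lambda>x. x + \<gamma>) ` A n'))
       \<le> torus_measure (A n) * torus_measure (A n')
         + K * (min (torus_measure (A n) / real n ^ CARD('k))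
                    (torus_measure (A n') / real n' ^ CARD('k))
                * real (gcd n n') ^ CARD('k)
                * (1 + (real n powr (\<tau> - 1 - 1 / real CARD('k))
                        + real n' powr (\<tau> - 1 - 1 / real CARD('k)))
                       / (real (gcd n n') / (real n * real n'))) ^ (CARD('k) - 1)))"
proof (intro exI conjI allI impI)
  \<comment> \<open>Three integers near each of the \<open>CARD('k)\<close> coordinate hyperplanes
    account for the first factors, \<open>error_term_le\<close> for the power. The constant is fixed
    before \<open>\<tau>\<close> and the system.\<close>
  define K where "K = 3 * real CARD('k) * (2 * C + 1) ^ (CARD('k) - 1)"
  show "0 < K" using assms by (simp add: K_def)
  fix \<tau> and A :: "nat \<Rightarrow> (real ^ 'k) set" and n n' :: nat and \<gamma> :: "real ^ 'k"
  assume adm: "admissible_system \<tau> 0 c C A" and n: "1 \<le> n" "1 \<le> n'"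
  define e where "e n = real n powr (\<tau> - 1 - 1 / real CARD('k))" for n
  define \<mu> where "\<mu> n = torus_measure (A n)" for n
  define P where "P n = periodize (A n)" for n
  have P_meas: "P n \<in> sets borel" "\<mu> n = measure lborel (P n \<inter> unit_cube)" if pos: "1 \<le> n" for n
  proof -
    obtain S where S: "S \<in> sets borel" "strongly_star_shaped S"
      "\<forall>x\<in>S. \<forall>j. \<bar>x $ j\<bar> < 1 / 2"
      "\<forall>x\<in>S. \<forall>j. \<bar>x $ j\<bar> < real n * (C * e n)"
      "P n = {x. real n *\<^sub>R x \<in> periodize S}"
      using admissible_system_star_shaped[OF adm pos] unfolding P_def e_def by blast
    then show "P n \<in> sets borel" by (simp add: borel_scale borel_periodize)
    then show "\<mu> n = measure lborel (P n \<inter> unit_cube)"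
      by (simp add: \<mu>_def P_def torus_measure_lborel)
  qed
  let ?err = "\<lambda>n n'. real (gcd n n') ^ CARD('k) * (1 + (e n + e n') / (real (gcd n n') / (real n * real n'))) ^ (CARD('k) - 1)"
  \<comment> \<open>Stated for arbitrary indices and shifts, since it is applied to both orders of
    \<open>n\<close> and \<open>n'\<close>, with opposite shifts.\<close>
  have overlap: "measure lborel (P n \<inter> {x. x + \<gamma> \<in> P n'} \<inter> unit_cube)
      \<le> \<mu> n * \<mu> n' + K * (\<mu> n / real n ^ CARD('k) * ?err n n')"
    if n: "1 \<le> n" "1 \<le> n'" for n n' :: nat and \<gamma> :: "real ^ 'k"
  proof -
    obtain S where S: "S \<in> sets borel" "strongly_star_shaped S"
      "\<forall>x\<in>S. \<forall>j. \<bar>x $ j\<bar> < 1 / 2"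
      "\<forall>x\<in>S. \<forall>j. \<bar>x $ j\<bar> < real n * (C * e n)"
      "P n = {x. real n *\<^sub>R x \<in> periodize S}"
      using admissible_system_star_shaped[OF adm n(1)] unfolding P_def e_def by blast
    obtain S' where S': "S' \<in> sets borel" "strongly_star_shaped S'"
      "\<forall>x\<in>S'. \<forall>j. \<bar>x $ j\<bar> < 1 / 2"
      "\<forall>x\<in>S'. \<forall>j. \<bar>x $ j\<bar> < real n' * (C * e n')"
      "P n' = {x. real n' *\<^sub>R x \<in> periodize S'}"
      using admissible_system_star_shaped[OF adm n(2)] unfolding P_def e_def by blast
    define X where "X = \<mu> n / real n ^ CARD('k) * real (gcd n n') ^ CARD('k)"
    \<comment> \<open>\<open>r\<close> is the reciprocal of \<open>gcd n n' / (n n')\<close>;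
      measured in steps of the lattice of mesh \<open>gcd n n' / n\<close>, the half-width of
      \<open>S'\<close> is \<open>C * e n' * r\<close>.\<close>
    define r where "r = real n * real n' / real (gcd n n')"
    have "0 \<le> real n' * (C * e n')" using assms by (simp add: e_def)
    then have "measure lborel (P n \<inter> {x. x + \<gamma> \<in> P n'} \<inter> unit_cube)
        \<le> \<mu> n * \<mu> n' + 3 * real CARD('k) * (X
          * (2 * (real n' * (C * e n')) * real n / real (gcd n n') + 1) ^ (CARD('k) - 1))"
      using measure_overlap_le[of n n' "periodize S" S' "real n' * (C * e n')" \<gamma>,
          OF _ _ periodic_periodize borel_periodize[OF S(1)] S'(1,2)
          S'(3)[rule_format] _ S'(4)[rule_format]] n
      by (simp add: P_meas X_def  flip: S(5) S'(5))
    also have "2 * (real n' * (C * e n')) * real n / real (gcd n n') = 2 * (C * e n') * r"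
      by (simp add: r_def)
    also have "3 * real CARD('k) * (X * (2 * (C * e n') * r + 1) ^ (CARD('k) - 1))
        \<le> K * (X * (1 + (e n' + e n) * r) ^ (CARD('k) - 1))"
      unfolding K_def using assms
      by (intro error_term_le) (auto simp: e_def r_def X_def \<mu>_def torus_measure_def)
    also have "(e n' + e n) * r = (e n + e n') / (real (gcd n n') / (real n * real n'))"
      by (simp add: r_def add.commute)
    finally show ?thesis by (simp add: X_def mult.assoc)
  qed
  have per: "periodic (P n)" for n by (simp add: P_def periodic_periodize)
  have shift: "periodize ((\<lambda>x. x + \<gamma>) ` A n') = {x. x + (- \<gamma>) \<in> P n'}"
    by (simp add: periodize_translate P_def)
  let ?I = "P n \<inter> {x. x + (- \<gamma>) \<in> P n'}"
  have I: "periodic ?I" "?I \<in> sets borel"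
    by (intro periodic_Int periodic_translate per)
      (intro sets.Int borel_translate P_meas(1) n)
  \<comment> \<open>The intersection is already periodic, so the periodization inside
    \<open>torus_measure\<close> leaves it unchanged.\<close>
  have tm: "torus_measure (periodize (A n) \<inter> periodize ((\<lambda>x. x + \<gamma>) ` A n')) = measure lborel (?I \<inter> unit_cube)"
    using I by (subst torus_measure_lborel) (simp_all add: shift P_def[symmetric] periodize_periodic)
  \<comment> \<open>Translation by \<open>\<gamma>\<close> exchanges the fixed and the displaced
    set, which makes \<open>overlap\<close> applicable in the other order.\<close>
  have "{x. x + \<gamma> \<in> ?I} = P n' \<inter> {x. x + \<gamma> \<in> P n}" by auto
  then have sym: "measure lborel (?I \<inter> unit_cube) = measure lborel (P n' \<inter> {x. x + \<gamma> \<in> P n} \<inter> unit_cube)"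
    using measure_torus_translate[OF I, of \<gamma>] by simp
  have err: "?err n' n = ?err n n'"
    by (simp only: gcd.commute[of n'] add.commute[of "e n'"] mult.commute[of "real n'"])
  define E where "E = ?err n n'"
  have "measure lborel (?I \<inter> unit_cube) \<le> \<mu> n * \<mu> n' + K * (\<mu> n / real n ^ CARD('k) * E)"
    unfolding E_def using n by (rule overlap)
  moreover have "measure lborel (?I \<inter> unit_cube) \<le> \<mu> n * \<mu> n' + K * (\<mu> n' / real n' ^ CARD('k) * E)"
    using overlap[OF n(2,1), of \<gamma>] unfolding E_def err sym by (simp only: mult.commute[of "\<mu> n'" "\<mu> n"])
  ultimately have "measure lborel (?I \<inter> unit_cube) \<le> \<mu> n * \<mu> n'
      + K * (min (\<mu> n / real n ^ CARD('k)) (\<mu> n' / real n' ^ CARD('k)) * E)"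
    unfolding min_def by presburger
  then show "torus_measure (periodize (A n) \<inter> periodize ((\<lambda>x. x + \<gamma>) ` A n'))
       \<le> torus_measure (A n) * torus_measure (A n')
         + K * (min (torus_measure (A n) / real n ^ CARD('k))
                    (torus_measure (A n') / real n' ^ CARD('k))
                * real (gcd n n') ^ CARD('k)
                * (1 + (real n powr (\<tau> - 1 - 1 / real CARD('k))
                        + real n' powr (\<tau> - 1 - 1 / real CARD('k)))
                       / (real (gcd n n') / (real n * real n'))) ^ (CARD('k) - 1))"
    unfolding tm E_def \<mu>_def e_def by (simp only: mult.assoc)
qed

end
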